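(* Let $A\in\mathbb{R}^{m\times n}$ and $(\bar b,\bar\lambda)\in\mathbb{R}^m\times\mathbb{R}_{++}$. Let $S(b,\lambda):=\mathrm{argmin}_{x\in\mathbb{R}^n}\{\|Ax-b\|+\lambda\|x\|_1\}$ be the solution mapping of the SR-LASSO problem. Suppose that $\{Ax:x\in S(\bar b,\bar\lambda)\}\ne\{\bar b\}$. Then $S$ is locally (Hausdorff) Lipschitzian at $(\bar b,\bar\lambda)$ if and only if there exists $\bar x\in S(\bar b,\bar\lambda)$ such that $A\bar x\ne\bar b$ and $\bar b\notin\mathrm{rge}(A_{J_{SR}})$, where $$J_{SR}=J_{SR}(\bar x):=\left\{i\in[n]:\left|A_i^T\frac{\bar b-A\bar x}{\|A\bar x-\bar b\|}\right|=\bar\lambda\right\}.$$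
   Context: $\mathbb{R}_{++}=(0,\infty)$, $[n]=\{1,\dots,n\}$; $\|\cdot\|$ is the Euclidean norm and $\|\cdot\|_1$ the $\ell_1$-norm. $A_i$ is the $i$-th column of $A$; for $I\subset[n]$, $A_I$ is the submatrix of columns of $A$ indexed by $I$, and $\mathrm{rge}(A_I)$ is its range ($\{0\}$ if $I=\emptyset$). A set-valued mapping $F$ is locally (Hausdorff) Lipschitzian at $\bar z$ if there are $\delta,L\in(0,\infty)$ with $d_H(F(z),F(z'))\le L\|z-z'\|$ for all $z,z'\in B(\bar z,\delta)$, where $d_H(C,D)=\max\{e(C,D),e(D,C)\}$, $e(C,D)=\sup_{x\in C}d(x,D)$. *)

theory Defs
  imports "HOL-Analysis.Analysis"
begin

text \<open>
  Excess and Hausdorff distance take values in \<open>ennreal\<close>: the supremum may be infinite, the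
  distance to the empty set is \<open>\<infinity>\<close> (whereas \<^const>\<open>infdist\<close> would give \<open>0\<close>), and the excess
  of the empty set is \<open>0\<close>.
\<close>

definition set_excess :: "'a::metric_space set \<Rightarrow> 'a set \<Rightarrow> ennreal" where
  "set_excess C D = (SUP x\<in>C. INF y\<in>D. ennreal (dist x y))"

definition hausdorff_distance :: "'a::metric_space set \<Rightarrow> 'a set \<Rightarrow> ennreal" where
  "hausdorff_distance C D = max (set_excess C D) (set_excess D C)"

definition locally_hausdorff_lipschitz_at ::
    "('a::real_normed_vector \<Rightarrow> 'b::metric_space set) \<Rightarrow> 'a \<Rightarrow> bool" where
  "locally_hausdorff_lipschitz_at F zbar \<longleftrightarrow>
     (\<exists>\<delta>>0. \<exists>L>0. \<forall>z\<in>ball zbar \<delta>. \<forall>z'\<in>ball zbar \<delta>.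
        hausdorff_distance (F z) (F z') \<le> ennreal (L * norm (z - z')))"

definition l1_norm :: "real ^ 'n \<Rightarrow> real" where
  "l1_norm x = (\<Sum>i\<in>UNIV. \<bar>x $ i\<bar>)"

text \<open>
  The solution mapping is total in the regularization parameter \<open>l\<close>. Local Lipschitz continuity at a point with
  \<open>l > 0\<close> does not depend on its values at \<open>l \<le> 0\<close>, because the radius of the ball can be
  shrunk. The norm on the product type is the Euclidean one.
\<close>

definition sr_lasso_solutions :: "real ^ 'n ^ 'm \<Rightarrow> (real ^ 'm) \<times> real \<Rightarrow> (real ^ 'n) set" where
  "sr_lasso_solutions A = (\<lambda>(b, l).
     {x. is_arg_min (\<lambda>x. norm (A *v x - b) + l * l1_norm x) (\<lambda>_. True) x})"

text \<open>
  The range of the column submatrix \<open>A\<^sub>I\<close>; the column index set \<open>I\<close> is not a type, so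
  the product of \<open>A\<^sub>I\<close> with a coefficient vector is written as a sum over \<open>I\<close>.
\<close>

definition rge_columns :: "real ^ 'n ^ 'm \<Rightarrow> 'n set \<Rightarrow> (real ^ 'm) set" where
  "rge_columns A I = range (\<lambda>c :: 'n \<Rightarrow> real. \<Sum>i\<in>I. c i *\<^sub>R column i A)"

text \<open>Only meaningful for \<open>A *v x \<noteq> b\<close>.\<close>

definition J_SR :: "real ^ 'n ^ 'm \<Rightarrow> real ^ 'm \<Rightarrow> real \<Rightarrow> real ^ 'n \<Rightarrow> 'n set" where
  "J_SR A b l x = {i. \<bar>column i A \<bullet> ((b - A *v x) /\<^sub>R norm (A *v x - b))\<bar> = l}"

end

theory Submission
  imports Defs
begin

text \<open>
  At a solution \<open>x\<close> with nonzero residual, the unit vector \<open>u\<close> in the direction of \<open>b - A x\<close>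
  solves the dual problem: \<open>\<bar>A\<^sub>i \<bullet> u\<bar> \<le> l\<close> for all \<open>i\<close>, with equality and equal signs wherever
  \<open>x\<^sub>i \<noteq> 0\<close>. Such a dual certificate is shared by all solutions of the same problem
  (\<open>dual_certificate_all_solutions\<close>). Hence all nonzero residuals point in the same direction,
  the set \<open>J\<close> of indices with \<open>\<bar>A\<^sub>i \<bullet> u\<bar> = l\<close> does not depend on the solution, and every
  solution is supported on \<open>J\<close> with the signs of \<open>A\<^sub>i \<bullet> u\<close>.

  Sufficiency of the range condition (\<open>locally_lipschitz_of_range_condition\<close>). If \<open>b\<close> is not in
  the range of \<open>A\<^sub>J\<close>, some unit vector \<open>w\<close> is orthogonal to the columns in \<open>J\<close> and has
  \<open>w \<bullet> b > 0\<close>. As long as solutions are supported on \<open>J\<close>, the component of the residual along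
  \<open>w\<close> is \<open>w \<bullet> b\<close>, so residuals stay away from zero, and by compactness their directions stay
  close to \<open>u\<close> when the parameters vary. Therefore all solutions for nearby parameters lie in one
  face of one orthant, and on this face \<open>l \<parallel>x\<parallel>\<^sub>1 = u \<bullet> A x\<close> depends on \<open>A x\<close> only. Adding the
  subgradient inequalities at two nearby parameters controls the change of the residual direction;
  the change of the residual length is then read off from the component along \<open>w\<close>. So the fitted
  value \<open>A x\<close> is unique and Lipschitz (\<open>fitted_value_lipschitz_bound\<close>). A nearby solution set is
  exactly the fibre of \<open>A\<close> over the fitted value within the fixed face, and a Hoffman bound
  (\<open>box_hoffman_bound\<close>) turns distances of fitted values into distances of solutions.

  Necessity (\<open>range_condition_of_locally_lipschitz\<close>). If \<open>b\<close> is in the range of \<open>A\<^sub>J\<close>, then so is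
  \<open>u\<close>, say \<open>u = A c\<close> with \<open>c\<close> supported on \<open>J\<close>. A small change of \<open>b\<close> that keeps the residual
  produces a solution whose support is all of \<open>J\<close>. Now increase \<open>l\<close> to \<open>l + \<eta>\<close>. A solution close
  to that one has the same signs on \<open>J\<close>, so its residual direction \<open>u'\<close> satisfies
  \<open>A\<^sub>i \<bullet> u' = (1 + \<eta> / l) (A\<^sub>i \<bullet> u)\<close> for \<open>i \<in> J\<close>; pairing with \<open>c\<close> gives \<open>u' \<bullet> u = 1 + \<eta> / l\<close>,
  which is impossible for unit vectors.
\<close>

section \<open>Duality for the square-root LASSO\<close>

lemma inner_matrix_vector_columns:
  fixes A :: "real ^ 'n ^ 'm"
  shows "u \<bullet> (A *v x) = (\<Sum>i\<in>UNIV. x $ i * (column i A \<bullet> u))"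
  by (simp add: matrix_mult_sum scalar_mult_eq_scaleR inner_sum_right inner_commute)

lemma l1_norm_triangle: "l1_norm (x + y) \<le> l1_norm x + l1_norm y"
  unfolding l1_norm_def by (simp add: sum.distrib [symmetric] sum_mono abs_triangle_ineq)

lemma l1_norm_scaleR: "l1_norm (c *\<^sub>R x) = \<bar>c\<bar> * l1_norm x"
  unfolding l1_norm_def by (simp add: abs_mult sum_distrib_left)

lemma l1_norm_0 [simp]: "l1_norm 0 = 0"
  unfolding l1_norm_def by simp

lemma l1_norm_nonneg: "0 \<le> l1_norm x"
  unfolding l1_norm_def by (simp add: sum_nonneg)

lemma norm_le_l1: "norm x \<le> l1_norm x"
  unfolding l1_norm_def by (rule norm_le_l1_cart)

lemma continuous_l1_norm [continuous_intros]: "continuous_on X l1_norm"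
  unfolding l1_norm_def [abs_def] by (intro continuous_intros)

lemma sr_lasso_solutions_iff:
  "x \<in> sr_lasso_solutions A (b, l) \<longleftrightarrow>
    (\<forall>y. norm (A *v x - b) + l * l1_norm x \<le> norm (A *v y - b) + l * l1_norm y)"
  unfolding sr_lasso_solutions_def is_arg_min_def by (auto simp: not_less)

text \<open>
  The conditions say that \<open>u\<close> is feasible for the dual problem
  \<open>max {b \<bullet> u | \<parallel>u\<parallel> \<le> 1, \<parallel>A\<^sup>T u\<parallel>\<^sub>\<infinity> \<le> l}\<close> and that \<open>x\<close> and \<open>u\<close> have no duality gap, which is
  split into its residual part and its coordinates so that support and signs of \<open>x\<close> can be read off.
\<close>

definition dual_certificate ::
    "real ^ 'n ^ 'm \<Rightarrow> real ^ 'm \<Rightarrow> real \<Rightarrow> real ^ 'n \<Rightarrow> real ^ 'm \<Rightarrow> bool" where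
  "dual_certificate A b l x u \<longleftrightarrow>
     norm u \<le> 1 \<and> u \<bullet> (b - A *v x) = norm (b - A *v x) \<and>
     (\<forall>i. \<bar>column i A \<bullet> u\<bar> \<le> l) \<and> (\<forall>i. x $ i * (column i A \<bullet> u) = l * \<bar>x $ i\<bar>)"

lemma mult_le_of_abs_le:
  fixes a l s :: real
  assumes "\<bar>a\<bar> \<le> l"
  shows "s * a \<le> l * \<bar>s\<bar>"
  using mult_left_mono [OF assms, of "\<bar>s\<bar>"] abs_ge_self [of "s * a"]
  by (simp add: abs_mult mult.commute)

lemma inner_le_l1_norm:
  assumes "\<And>i. \<bar>column i A \<bullet> u\<bar> \<le> l"
  shows "u \<bullet> (A *v y) \<le> l * l1_norm y"
  unfolding inner_matrix_vector_columns l1_norm_def sum_distrib_left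
  by (intro sum_mono mult_le_of_abs_le assms)

lemma dual_certificate_attained:
  assumes "dual_certificate A b l x u"
  shows "u \<bullet> (A *v x) = l * l1_norm x"
  using assms unfolding dual_certificate_def inner_matrix_vector_columns l1_norm_def sum_distrib_left
  by simp

text \<open>
  Weak duality: \<open>b \<bullet> u\<close> is a lower bound of the objective for every dual feasible \<open>u\<close>, and it is
  the objective value at \<open>x\<close>.
\<close>

lemma dual_certificate_imp_solution:
  assumes "dual_certificate A b l x u"
  shows "x \<in> sr_lasso_solutions A (b, l)"
  unfolding sr_lasso_solutions_iff
proof
  fix y
  have "u \<bullet> (b - A *v y) \<le> norm u * norm (b - A *v y)" by (rule norm_cauchy_schwarz)
  also have "\<dots> \<le> norm (b - A *v y)"
    using assms by (simp add: dual_certificate_def mult_left_le_one_le)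
  finally have "u \<bullet> b \<le> norm (b - A *v y) + l * l1_norm y"
    using inner_le_l1_norm [of A u l y] assms by (simp add: dual_certificate_def inner_diff_right)
  moreover have "norm (b - A *v x) + l * l1_norm x = u \<bullet> b"
    using assms dual_certificate_attained [OF assms]
    by (simp add: dual_certificate_def inner_diff_right)
  ultimately show "norm (A *v x - b) + l * l1_norm x \<le> norm (A *v y - b) + l * l1_norm y"
    by (simp add: norm_minus_commute)
qed

text \<open>
  The objective is compared along the segment from \<open>x\<close> to \<open>y\<close>: the \<open>\<ell>\<^sub>1\<close> part is convex, and at a
  nonzero residual the norm part has first-order expansion with slope given by the unit residual.
\<close>

lemma solution_subgradient:
  assumes x: "x \<in> sr_lasso_solutions A (b, l)" and l: "0 \<le> l" and ne: "A *v x \<noteq> b"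
  shows "sgn (b - A *v x) \<bullet> (A *v y - A *v x) \<le> l * (l1_norm y - l1_norm x)"
proof -
  define r where "r = b - A *v x"
  define d where "d = A *v y - A *v x"
  define \<rho> where "\<rho> = norm r"
  have \<rho>: "\<rho> > 0" using ne by (simp add: \<rho>_def r_def)
  define k where "k = (norm d)\<^sup>2 / (2 * \<rho>)"
  have ineq: "sgn r \<bullet> d \<le> l * (l1_norm y - l1_norm x) + t * k" if t: "0 < t" "t \<le> 1" for t
  proof -
    define p where "p = (1 - t) *\<^sub>R x + t *\<^sub>R y"
    have Ap: "A *v p - b = - (r - t *\<^sub>R d)"
      by (simp add: p_def r_def d_def matrix_vector_right_distrib scaleR_matrix_vector_assoc [symmetric]
          matrix_vector_mult_scaleR algebra_simps)
    \<comment> \<open>First-order expansion with explicit error, from \<open>2 q \<rho> \<le> q\<^sup>2 + \<rho>\<^sup>2\<close>.\<close>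
    have np: "norm (A *v p - b) \<le> \<rho> - t * (sgn r \<bullet> d) + t\<^sup>2 * k"
    proof -
      define q where "q = norm (r - t *\<^sub>R d)"
      have "q\<^sup>2 = \<rho>\<^sup>2 - 2 * t * (r \<bullet> d) + t\<^sup>2 * (norm d)\<^sup>2"
        unfolding q_def \<rho>_def power2_norm_eq_inner
        by (simp add: algebra_simps inner_commute power2_eq_square)
      moreover have "2 * q * \<rho> \<le> q\<^sup>2 + \<rho>\<^sup>2"
        using zero_le_power2 [of "q - \<rho>"] by (simp add: power2_diff)
      moreover have "(\<rho> - t * ((r \<bullet> d) / \<rho>) + t\<^sup>2 * k) * (2 * \<rho>) =
          2 * \<rho>\<^sup>2 - 2 * t * (r \<bullet> d) + t\<^sup>2 * (norm d)\<^sup>2"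
        using \<rho> by (simp add: k_def field_simps power2_eq_square)
      ultimately have "q * (2 * \<rho>) \<le> (\<rho> - t * ((r \<bullet> d) / \<rho>) + t\<^sup>2 * k) * (2 * \<rho>)"
        by linarith
      then have "q \<le> \<rho> - t * ((r \<bullet> d) / \<rho>) + t\<^sup>2 * k"
        using \<rho> by simp
      moreover have "norm (A *v p - b) = q" unfolding Ap q_def by (rule norm_minus_cancel)
      moreover have "sgn r \<bullet> d = (r \<bullet> d) / \<rho>" by (simp add: sgn_div_norm \<rho>_def divide_inverse mult.commute)
      ultimately show ?thesis by simp
    qed
    have "l1_norm p \<le> (1 - t) * l1_norm x + t * l1_norm y"
      unfolding p_def using l1_norm_triangle [of "(1 - t) *\<^sub>R x" "t *\<^sub>R y"] t
      by (simp add: l1_norm_scaleR)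
    then have "l * l1_norm p \<le> l * ((1 - t) * l1_norm x + t * l1_norm y)"
      using l by (rule mult_left_mono)
    moreover have "\<rho> + l * l1_norm x \<le> norm (A *v p - b) + l * l1_norm p"
      using x unfolding sr_lasso_solutions_iff \<rho>_def r_def by (simp add: norm_minus_commute)
    ultimately have "t * (sgn r \<bullet> d) \<le> t * (l * (l1_norm y - l1_norm x) + t * k)"
      using np by (simp add: algebra_simps power2_eq_square)
    then show ?thesis using t by simp
  qed
  have "((\<lambda>t. l * (l1_norm y - l1_norm x) + t * k) \<longlongrightarrow> l * (l1_norm y - l1_norm x) + 0 * k) (at_right 0)"
    by (intro tendsto_intros)
  moreover have "\<forall>\<^sub>F t in at_right 0. sgn r \<bullet> d \<le> l * (l1_norm y - l1_norm x) + t * k"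
    unfolding eventually_at_right_field using ineq by (intro exI [of _ 1]) auto
  ultimately have "sgn r \<bullet> d \<le> l * (l1_norm y - l1_norm x) + 0 * k"
    by (rule tendsto_lowerbound) simp
  then show ?thesis by (simp add: r_def d_def)
qed

lemma inner_sgn_self: "sgn r \<bullet> r = norm r" for r :: "'a::real_inner"
  by (cases "r = 0") (simp_all add: sgn_div_norm dot_square_norm power2_eq_square)

text \<open>
  The coordinatewise identities follow from their sum, because each of them holds as an inequality
  by dual feasibility.
\<close>

lemma dual_certificate_eqI:
  assumes "norm u \<le> 1" "u \<bullet> (b - A *v x) = norm (b - A *v x)"
    and bd: "\<And>i. \<bar>column i A \<bullet> u\<bar> \<le> l" and att: "l * l1_norm x \<le> u \<bullet> (A *v x)"
  shows "dual_certificate A b l x u"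
proof -
  have le: "x $ i * (column i A \<bullet> u) \<le> l * \<bar>x $ i\<bar>" for i
    using bd by (rule mult_le_of_abs_le)
  have "(\<Sum>i\<in>UNIV. l * \<bar>x $ i\<bar> - x $ i * (column i A \<bullet> u)) \<le> 0"
    using att by (simp add: inner_matrix_vector_columns l1_norm_def sum_distrib_left sum_subtractf)
  then have "\<forall>i\<in>UNIV. l * \<bar>x $ i\<bar> - x $ i * (column i A \<bullet> u) = 0"
    using le by (subst sum_nonneg_eq_0_iff [symmetric]) (auto intro!: antisym sum_nonneg)
  then show ?thesis using assms(1,2) bd by (simp add: dual_certificate_def)
qed

text \<open>
  Coordinate directions in the subgradient inequality give dual feasibility of the unit residual;
  comparison with \<open>0\<close> gives that the \<open>\<ell>\<^sub>1\<close> term has no gap.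
\<close>

lemma solution_dual_certificate:
  fixes A :: "real ^ 'n ^ 'm"
  assumes x: "x \<in> sr_lasso_solutions A (b, l)" and l: "0 \<le> l" and ne: "A *v x \<noteq> b"
  shows "dual_certificate A b l x (sgn (b - A *v x))"
proof (rule dual_certificate_eqI)
  let ?u = "sgn (b - A *v x)"
  show "norm ?u \<le> 1" by (simp add: norm_sgn)
  show "?u \<bullet> (b - A *v x) = norm (b - A *v x)" by (rule inner_sgn_self)
  show "l * l1_norm x \<le> ?u \<bullet> (A *v x)"
    using solution_subgradient [OF assms, of 0] by simp
  fix i
  have dir: "?u \<bullet> (A *v v) \<le> l * l1_norm v" for v
  proof -
    have "?u \<bullet> (A *v v) \<le> l * (l1_norm (x + v) - l1_norm x)"
      using solution_subgradient [OF assms, of "x + v"] by (simp add: matrix_vector_right_distrib)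
    also have "\<dots> \<le> l * l1_norm v"
      using l1_norm_triangle [of x v] l by (intro mult_left_mono) auto
    finally show ?thesis .
  qed
  have "\<bar>(axis i 1 :: real ^ 'n) $ j\<bar> = (if j = i then 1 else 0)" for j
    by (simp add: axis_def)
  then have ax: "l1_norm (axis i 1 :: real ^ 'n) = 1"
    by (simp add: l1_norm_def)
  have "?u \<bullet> column i A \<le> l"
    using dir [of "axis i 1"] by (simp add: ax matrix_vector_mult_basis)
  moreover have "- (?u \<bullet> column i A) \<le> l"
    using dir [of "(-1) *\<^sub>R axis i 1"] 
    by (simp only: l1_norm_scaleR matrix_vector_mult_scaleR matrix_vector_mult_basis inner_scaleR_right ax)
  ultimately show "\<bar>column i A \<bullet> ?u\<bar> \<le> l" by (simp add: inner_commute)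
qed

text \<open>
  All solutions have the objective value \<open>b \<bullet> u\<close>, so the two inequalities of weak duality are
  equalities at each of them. This is why support, signs and residual direction, read off from one
  solution, constrain every other one.
\<close>

lemma dual_certificate_all_solutions:
  assumes u: "dual_certificate A b l x u" and x': "x' \<in> sr_lasso_solutions A (b, l)"
  shows "dual_certificate A b l x' u"
proof -
  have bd: "\<And>i. \<bar>column i A \<bullet> u\<bar> \<le> l" and nu: "norm u \<le> 1"
    using u by (auto simp: dual_certificate_def)
  have 1: "u \<bullet> (A *v x') \<le> l * l1_norm x'" using bd by (rule inner_le_l1_norm)
  have "u \<bullet> (b - A *v x') \<le> norm u * norm (b - A *v x')" by (rule norm_cauchy_schwarz)
  also have "\<dots> \<le> norm (b - A *v x')" using nu by (simp add: mult_left_le_one_le)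
  finally have 2: "u \<bullet> (b - A *v x') \<le> norm (b - A *v x')" .
  have "norm (b - A *v x) + l * l1_norm x = u \<bullet> b"
    using u dual_certificate_attained [OF u] by (simp add: dual_certificate_def inner_diff_right)
  then have 3: "norm (b - A *v x') + l * l1_norm x' \<le> u \<bullet> b"
    using x' unfolding sr_lasso_solutions_iff by (metis norm_minus_commute)
  show ?thesis
    by (rule dual_certificate_eqI [OF nu _ bd]) (use 1 2 3 in \<open>simp_all add: inner_diff_right\<close>)
qed

lemma unit_inner_eq_norm:
  fixes u r :: "'a::real_inner"
  assumes "norm u = 1" "u \<bullet> r = norm r"
  shows "r = norm r *\<^sub>R u"
  using assms by (metis mult_1 norm_cauchy_schwarz_eq scaleR_one)

text \<open>
Comparison with \<open>x = 0\<close>; this bounds residuals and, for \<open>l\<close> away from \<open>0\<close>, solutions.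
\<close>

lemma solution_l1_bound:
  assumes "x \<in> sr_lasso_solutions A (b, l)"
  shows "norm (b - A *v x) + l * l1_norm x \<le> norm b"
  using assms [unfolded sr_lasso_solutions_iff, rule_format, of 0]
  by (simp add: norm_minus_commute)

lemma solutions_nonempty:
  fixes A :: "real ^ 'n ^ 'm"
  assumes "0 < l"
  shows "sr_lasso_solutions A (b, l) \<noteq> {}"
proof -
  let ?f = "\<lambda>x. norm (A *v x - b) + l * l1_norm x"
  have "continuous_on (cball 0 (norm b / l)) ?f"
    by (intro continuous_intros continuous_on_compose2 [OF continuous_l1_norm])
      auto
  moreover have "cball (0 :: real ^ 'n) (norm b / l) \<noteq> {}"
    using assms by (simp add: not_less)
  ultimately obtain x where x: "x \<in> cball 0 (norm b / l)" "\<And>y. y \<in> cball 0 (norm b / l) \<Longrightarrow> ?f x \<le> ?f y"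
    using continuous_attains_inf [of "cball 0 (norm b / l)" ?f] compact_cball by blast
  have "?f x \<le> ?f y" for y
  proof (cases "y \<in> cball 0 (norm b / l)")
    case False
    then have "norm b < l * norm y" using assms by (simp add: field_simps)
    also have "\<dots> \<le> l * l1_norm y" using assms norm_le_l1 [of y] by simp
    finally have "?f 0 \<le> ?f y" using norm_ge_zero [of "A *v y - b"] by (simp del: norm_ge_zero)
    moreover have "?f x \<le> ?f 0" using assms by (intro x) simp
    ultimately show ?thesis by linarith
  qed (use x in auto)
  then have "x \<in> sr_lasso_solutions A (b, l)" by (simp add: sr_lasso_solutions_iff)
  then show ?thesis by auto
qed

section \<open>A Hoffman bound for fibres of a matrix in a box\<close>

text \<open>
  The vectors that are positive only on the first and negative only on the second index set. A
  pair of sets encodes the sign pattern so that the patterns form a finite type, over which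
  constants can be minimised.
\<close>

definition sign_cone :: "'n set \<times> 'n set \<Rightarrow> (real ^ 'n) set" where
  "sign_cone s = {v. \<forall>i. (0 < v $ i \<longrightarrow> i \<in> fst s) \<and> (v $ i < 0 \<longrightarrow> i \<in> snd s)}"

lemma sign_cone_bound:
  fixes A :: "real ^ 'n ^ 'm"
  assumes inj: "\<And>v. v \<in> sign_cone s \<Longrightarrow> A *v v = 0 \<Longrightarrow> v = 0"
  shows "\<exists>c>0. \<forall>v\<in>sign_cone s. c * norm v \<le> norm (A *v v)"
proof (cases "sign_cone s \<inter> sphere 0 1 = {}")
  case True
  have zero: "v = 0" if "v \<in> sign_cone s" for v
  proof (rule ccontr)
    assume "v \<noteq> 0"
    then have "(1 / norm v) *\<^sub>R v \<in> sign_cone s \<inter> sphere 0 1"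
      using that by (auto simp: sign_cone_def zero_less_divide_iff divide_less_0_iff)
    with True show False by auto
  qed
  have "1 * norm v \<le> norm (A *v v)" if "v \<in> sign_cone s" for v
    using zero [OF that] by simp
  then show ?thesis using zero_less_one by blast
next
  case False
  have "sign_cone s = (\<Inter>i. {v. i \<notin> fst s \<longrightarrow> v $ i \<le> 0} \<inter> {v. i \<notin> snd s \<longrightarrow> 0 \<le> v $ i})"
    by (auto simp: sign_cone_def not_less)
  also have "closed \<dots>"
    by (intro closed_INT ballI closed_Int closed_Collect_imp closed_Collect_le continuous_intros) auto
  finally have "compact (sign_cone s \<inter> sphere 0 1)"
    by (intro closed_Int_compact) auto
  moreover have "continuous_on (sign_cone s \<inter> sphere 0 1) (\<lambda>v. norm (A *v v))"
    by (intro continuous_intros)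
  ultimately obtain v where v: "v \<in> sign_cone s \<inter> sphere 0 1"
    "\<And>y. y \<in> sign_cone s \<inter> sphere 0 1 \<Longrightarrow> norm (A *v v) \<le> norm (A *v y)"
    using continuous_attains_inf False by metis
  have "norm (A *v v) * norm y \<le> norm (A *v y)" if y: "y \<in> sign_cone s" for y
  proof (cases "y = 0")
    case False
    then have "(1 / norm y) *\<^sub>R y \<in> sign_cone s \<inter> sphere 0 1"
      using y by (auto simp: sign_cone_def zero_less_divide_iff divide_less_0_iff)
    from v(2) [OF this] False show ?thesis
      by (simp add: matrix_vector_mult_scaleR field_simps)
  qed simp
  moreover have "norm (A *v v) > 0" using inj [of v] v(1) by auto
  ultimately show ?thesis by blast
qed

text \<open>
  Let \<open>x'\<close> be the point of the fibre closest to \<open>x\<close>. If the sign pattern of \<open>h = x' - x\<close> admitted a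
  nonzero kernel vector \<open>v\<close> of \<open>A\<close>, subtracting a small multiple of \<open>v\<close> from \<open>x'\<close> would move each
  coordinate towards that of \<open>x\<close>, hence stay in the box and in the fibre, and come closer to \<open>x\<close>.
  So \<open>A\<close> has no nonzero kernel vector in the sign cone of \<open>h\<close>, which bounds \<open>\<parallel>h\<parallel>\<close> by \<open>\<parallel>A h\<parallel>\<close> with a
  constant depending on the sign pattern only, and there are finitely many patterns.
\<close>

lemma box_hoffman_bound:
  fixes A :: "real ^ 'n ^ 'm"
  assumes T: "\<And>i. closed (T i)" "\<And>i. convex (T i)"
  obtains L where "0 < L"
    "\<And>x x0. (\<And>i. x $ i \<in> T i) \<Longrightarrow> (\<And>i. x0 $ i \<in> T i) \<Longrightarrow>
      \<exists>x'. (\<forall>i. x' $ i \<in> T i) \<and> A *v x' = A *v x0 \<and> norm (x' - x) \<le> L * norm (A *v x0 - A *v x)"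
proof -
  have "\<exists>c>0. (\<forall>v\<in>sign_cone s. A *v v = 0 \<longrightarrow> v = 0) \<longrightarrow> (\<forall>v\<in>sign_cone s. c * norm v \<le> norm (A *v v))" for s
  proof (cases "\<forall>v\<in>sign_cone s. A *v v = 0 \<longrightarrow> v = 0")
    case True
    then show ?thesis using sign_cone_bound [of s A] by blast
  qed (auto intro: exI [of _ 1])
  then obtain c where c: "\<And>s. 0 < c s"
    "\<And>s v. (\<forall>v\<in>sign_cone s. A *v v = 0 \<longrightarrow> v = 0) \<Longrightarrow> v \<in> sign_cone s \<Longrightarrow> c s * norm v \<le> norm (A *v v)"
    by metis
  define m where "m = Min (range c)"
  have m: "0 < m" "\<And>s. m \<le> c s"
    unfolding m_def using c(1) by auto
  show thesis
  proof (rule that [of "1 / m"])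
    fix x x0 :: "real ^ 'n"
    assume x: "\<And>i. x $ i \<in> T i" and x0: "\<And>i. x0 $ i \<in> T i"
    define F where "F = {y. (\<forall>i. y $ i \<in> T i) \<and> A *v y = A *v x0}"
    have "closed ((\<lambda>y :: real ^ 'n. y $ i) -` T i)" for i
      using T by (intro closed_vimage continuous_intros) auto
    moreover have "closed {y. A *v y = A *v x0}"
      by (intro closed_Collect_eq continuous_intros)
    ultimately have "closed ((\<Inter>i. (\<lambda>y. y $ i) -` T i) \<inter> {y. A *v y = A *v x0})"
      by (intro closed_Int closed_INT) auto
    moreover have "F = (\<Inter>i. (\<lambda>y. y $ i) -` T i) \<inter> {y. A *v y = A *v x0}"
      by (auto simp: F_def)
    ultimately have "closed F" by simp
    have "convex F"
      unfolding F_def convex_def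
    proof (intro ballI allI impI, clarsimp, intro conjI allI)
      fix y z :: "real ^ 'n" and u v :: real and i
      assume *: "\<forall>i. y $ i \<in> T i" "\<forall>i. z $ i \<in> T i" "0 \<le> u" "0 \<le> v" "u + v = 1"
        "A *v y = A *v x0" "A *v z = A *v x0"
      show "u * y $ i + v * z $ i \<in> T i"
        using T * convexD [of "T i" "y $ i" "z $ i" u v] by simp
      show "A *v (u *\<^sub>R y + v *\<^sub>R z) = A *v x0"
        using * by (simp add: matrix_vector_right_distrib matrix_vector_mult_scaleR
            scaleR_left_distrib [symmetric])
    qed
    define x' where "x' = closest_point F x"
    have "x0 \<in> F" using x0 by (simp add: F_def)
    then have x'F: "x' \<in> F" unfolding x'_def by (intro closest_point_in_set \<open>closed F\<close>) auto
    have dot: "(x - x') \<bullet> (y - x') \<le> 0" if "y \<in> F" for y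
      unfolding x'_def using \<open>convex F\<close> \<open>closed F\<close> that by (rule closest_point_dot)
    define h where "h = x' - x"
    define s where "s = ({i. 0 < h $ i}, {i. h $ i < 0})"
    have "v = 0" if v: "v \<in> sign_cone s" "A *v v = 0" for v
    proof (rule ccontr)
      assume "v \<noteq> 0"
      have sgn: "0 < v $ i \<Longrightarrow> 0 < h $ i" "v $ i < 0 \<Longrightarrow> h $ i < 0" for i
        using v(1) by (auto simp: sign_cone_def s_def)
      \<comment> \<open>A step that overshoots no coordinate of \<open>x\<close>; the value 1 is a placeholder at zeros of \<open>v\<close>.\<close>
      define e where "e = Min (range (\<lambda>i. if v $ i = 0 then 1 else h $ i / v $ i))"
      have e_le: "e \<le> (if v $ i = 0 then 1 else h $ i / v $ i)" for i
        unfolding e_def by (rule Min_le) auto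
      have e: "0 < e" 
        unfolding e_def using sgn by (subst Min_gr_iff) (auto simp: zero_less_divide_iff neq_iff)
      have "x' - e *\<^sub>R v \<in> F"
        unfolding F_def
      proof (safe)
        fix i
        have "x' $ i - e * v $ i \<in> closed_segment (x $ i) (x' $ i)"
          using sgn [of i] e e_le [of i] mult_pos_pos [of e "v $ i"] mult_pos_neg [of e "v $ i"]
          by (cases "v $ i" "0 :: real" rule: linorder_cases)
            (auto simp: closed_segment_eq_real_ivl h_def field_simps)
        then show "(x' - e *\<^sub>R v) $ i \<in> T i"
          using T x x'F closed_segment_subset [of "x $ i" "T i" "x' $ i"]
          by (auto simp: F_def)
        show "A *v (x' - e *\<^sub>R v) = A *v x0"
          using x'F v(2) by (simp add: F_def matrix_vector_mult_diff_distrib matrix_vector_mult_scaleR)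
      qed
      then have "e * (h \<bullet> v) \<le> 0"
        using dot [of "x' - e *\<^sub>R v"] by (simp add: h_def inner_diff_left algebra_simps)
      moreover have "0 < h \<bullet> v"
      proof -
        from \<open>v \<noteq> 0\<close> obtain j where "v $ j \<noteq> 0" by (auto simp: vec_eq_iff)
        then have "0 < h $ j * v $ j" using sgn [of j] by (auto simp: neq_iff mult_neg_neg)
        moreover have "0 \<le> h $ i * v $ i" for i
          using sgn [of i] by (cases "v $ i" "0 :: real" rule: linorder_cases) (auto simp: mult_neg_neg less_imp_le)
        ultimately show ?thesis
          unfolding inner_vec_def by (intro sum_pos2 [of _ j]) auto
      qed
      ultimately show False using e by (simp add: mult_le_0_iff)
    qed
    moreover have "h \<in> sign_cone s" by (auto simp: sign_cone_def s_def)
    ultimately have "c s * norm h \<le> norm (A *v h)" by (intro c) auto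
    with m(2) [of s] have "m * norm h \<le> norm (A *v h)"
      by (meson mult_right_mono norm_ge_zero order_trans)
    also have "A *v h = A *v x0 - A *v x"
      using x'F by (simp add: h_def F_def matrix_vector_mult_diff_distrib)
    finally have "norm (x' - x) \<le> 1 / m * norm (A *v x0 - A *v x)"
      using m by (simp add: h_def field_simps)
    with x'F show "\<exists>x'. (\<forall>i. x' $ i \<in> T i) \<and> A *v x' = A *v x0 \<and>
        norm (x' - x) \<le> 1 / m * norm (A *v x0 - A *v x)"
      by (auto simp: F_def)
  qed (use m in simp)
qed

section \<open>Excess of sets and separation from a column range\<close>

lemma set_excess_leI:
  assumes "\<And>x. x \<in> C \<Longrightarrow> \<exists>y\<in>D. dist x y \<le> e"
  shows "set_excess C D \<le> ennreal e"
  unfolding set_excess_def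
proof (rule SUP_least)
  fix x assume "x \<in> C"
  then obtain y where "y \<in> D" "dist x y \<le> e" using assms by blast
  then show "(INF y\<in>D. ennreal (dist x y)) \<le> ennreal e"
    by (intro INF_lower2 [of y] ennreal_leI)
qed

lemma set_excess_leD:
  assumes "set_excess C D \<le> ennreal e" "x \<in> C" "e < e'" "0 < e'"
  shows "\<exists>y\<in>D. dist x y < e'"
proof -
  have "(INF y\<in>D. ennreal (dist x y)) \<le> set_excess C D"
    unfolding set_excess_def using \<open>x \<in> C\<close> by (rule SUP_upper)
  also have "\<dots> < ennreal e'"
    using assms by (intro le_less_trans [OF assms(1)] ennreal_lessI)
  finally obtain y where "y \<in> D" "ennreal (dist x y) < ennreal e'"
    by (auto simp: INF_less_iff)
  then show ?thesis by (auto simp: ennreal_less_iff)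
qed

text \<open>
  The witness is the normalised component of \<open>b\<close> orthogonal to the columns in \<open>J\<close>.
\<close>

lemma rge_columns_separation:
  fixes A :: "real ^ 'n ^ 'm"
  assumes "b \<notin> rge_columns A J"
  obtains w where "norm w = 1" "\<And>i. i \<in> J \<Longrightarrow> w \<bullet> column i A = 0" "0 < w \<bullet> b"
proof -
  let ?S = "(\<lambda>i. column i A) ` J"
  have "subspace (rge_columns A J)"
  proof (rule subspaceI)
    show "0 \<in> rge_columns A J"
      by (auto simp: rge_columns_def image_iff intro!: exI [of _ "\<lambda>_. 0"])
    fix x y assume "x \<in> rge_columns A J" "y \<in> rge_columns A J"
    then obtain c d where "x = (\<Sum>i\<in>J. c i *\<^sub>R column i A)" "y = (\<Sum>i\<in>J. d i *\<^sub>R column i A)"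
      by (auto simp: rge_columns_def)
    then show "x + y \<in> rge_columns A J"
      by (auto simp: rge_columns_def image_iff scaleR_left_distrib sum.distrib
          intro!: exI [of _ "\<lambda>i. c i + d i"])
  next
    fix r x assume "x \<in> rge_columns A J"
    then obtain c where "x = (\<Sum>i\<in>J. c i *\<^sub>R column i A)"
      by (auto simp: rge_columns_def)
    then show "r *\<^sub>R x \<in> rge_columns A J"
      by (auto simp: rge_columns_def image_iff scaleR_right.sum intro!: exI [of _ "\<lambda>i. r * c i"])
  qed
  moreover have "?S \<subseteq> rge_columns A J"
  proof clarify
    fix i assume "i \<in> J"
    have "(\<Sum>j\<in>J. (if j = i then 1 else 0) *\<^sub>R column j A) = (\<Sum>j\<in>J. if j = i then column j A else 0)"
      by (rule sum.cong) auto
    also have "\<dots> = column i A" using \<open>i \<in> J\<close> by simp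
    finally show "column i A \<in> rge_columns A J"
      unfolding rge_columns_def
      by (intro range_eqI [of _ _ "\<lambda>j. if j = i then 1 else 0"]) (rule sym)
  qed
  ultimately have "span ?S \<subseteq> rge_columns A J" by (rule span_minimal [rotated])
  obtain y z where yz: "y \<in> span ?S" "\<And>v. v \<in> span ?S \<Longrightarrow> orthogonal z v" "b = y + z"
    using orthogonal_subspace_decomp_exists [of ?S b] by metis
  have "z \<noteq> 0" using yz \<open>span ?S \<subseteq> rge_columns A J\<close> assms by auto
  show thesis
  proof (rule that [of "sgn z"])
    show "norm (sgn z) = 1" using \<open>z \<noteq> 0\<close> by (simp add: norm_sgn)
    show "sgn z \<bullet> column i A = 0" if "i \<in> J" for i
      using yz(2) [of "column i A"] that by (simp add: span_base orthogonal_def sgn_div_norm)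
    have "sgn z \<bullet> b = sgn z \<bullet> z"
      using yz(2) [OF yz(1)] by (simp add: yz(3) inner_add_right orthogonal_def sgn_div_norm)
    then show "0 < sgn z \<bullet> b" using \<open>z \<noteq> 0\<close> by (simp add: inner_sgn_self)
  qed
qed

section \<open>Stability of solutions and residual directions\<close>

text \<open>
  Solutions are bounded near a positive regularisation parameter, and minimality passes to the
  limit because the objective is jointly continuous in parameters and argument.
\<close>

lemma solutions_subsequence_limit:
  fixes A :: "real ^ 'n ^ 'm"
  assumes z: "(\<lambda>n. (b n, l n)) \<longlonglongrightarrow> (b0, l0)" and l0: "0 < l0"
    and x: "\<And>n. x n \<in> sr_lasso_solutions A (b n, l n)"
  obtains x0 r where "x0 \<in> sr_lasso_solutions A (b0, l0)" "strict_mono r" "(x \<circ> r) \<longlonglongrightarrow> x0"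
proof -
  have b: "b \<longlonglongrightarrow> b0" and l: "l \<longlonglongrightarrow> l0"
    using tendsto_fst [OF z] tendsto_snd [OF z] by simp_all
  have "\<forall>\<^sub>F n in sequentially. l0 / 2 < l n"
    using l by (rule order_tendstoD) (use l0 in simp)
  moreover have "\<forall>\<^sub>F n in sequentially. norm (b n) < norm b0 + 1"
    using tendsto_norm [OF b] by (rule order_tendstoD) simp
  ultimately have "\<forall>\<^sub>F n in sequentially. norm (x n) \<le> 2 * (norm b0 + 1) / l0"
  proof eventually_elim
    case (elim n)
    have "l0 / 2 * norm (x n) \<le> l n * l1_norm (x n)"
      using elim l0 norm_le_l1 [of "x n"] by (intro mult_mono) auto
    also have "\<dots> \<le> norm b0 + 1"
      using solution_l1_bound [OF x, of n] elim norm_ge_zero [of "b n - A *v x n"] by linarith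
    finally show ?case using l0 by (simp add: field_simps)
  qed
  then have "Bseq x" by (rule BfunI)
  then have "bounded (range x)" by (simp add: Bseq_eq_bounded)
  then obtain x0 r where r: "strict_mono r" "(x \<circ> r) \<longlonglongrightarrow> x0"
    using bounded_imp_convergent_subsequence by blast
  have br: "(\<lambda>n. b (r n)) \<longlonglongrightarrow> b0" and lr: "(\<lambda>n. l (r n)) \<longlonglongrightarrow> l0"
    using b l r(1) LIMSEQ_subseq_LIMSEQ unfolding o_def by blast+
  have xr: "(\<lambda>n. x (r n)) \<longlonglongrightarrow> x0" using r(2) by (simp add: o_def)
  have l1r: "(\<lambda>n. l1_norm (x (r n))) \<longlonglongrightarrow> l1_norm x0"
    using continuous_on_tendsto_compose [OF continuous_l1_norm [of UNIV] xr] by simp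
  have Axr: "(\<lambda>n. A *v x (r n)) \<longlonglongrightarrow> A *v x0"
    using xr by (rule bounded_linear.tendsto [OF matrix_vector_mul_bounded_linear])
  have "norm (A *v x0 - b0) + l0 * l1_norm x0 \<le> norm (A *v y - b0) + l0 * l1_norm y" for y
  proof (rule LIMSEQ_le)
    show "(\<lambda>n. norm (A *v x (r n) - b (r n)) + l (r n) * l1_norm (x (r n)))
        \<longlonglongrightarrow> norm (A *v x0 - b0) + l0 * l1_norm x0"
      by (intro tendsto_intros br lr l1r Axr)
    show "(\<lambda>n. norm (A *v y - b (r n)) + l (r n) * l1_norm y)
        \<longlonglongrightarrow> norm (A *v y - b0) + l0 * l1_norm y"
      by (intro tendsto_intros br lr)
    show "\<exists>N. \<forall>n\<ge>N. norm (A *v x (r n) - b (r n)) + l (r n) * l1_norm (x (r n))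
        \<le> norm (A *v y - b (r n)) + l (r n) * l1_norm y"
      using x unfolding sr_lasso_solutions_iff by blast
  qed
  then have "x0 \<in> sr_lasso_solutions A (b0, l0)" by (simp add: sr_lasso_solutions_iff)
  then show thesis using r that by blast
qed

text \<open>
  For the parameters \<open>(b0, l0)\<close> the residual direction is the single vector \<open>u\<close>. Since limits of
  solutions are solutions, every property that holds for pairs near \<open>(u, l0)\<close> is inherited by the
  residual directions of all solutions at nearby parameters.
\<close>

lemma residual_direction_stable:
  fixes A :: "real ^ 'n ^ 'm"
  assumes l0: "0 < l0"
    and nz: "\<And>x. x \<in> sr_lasso_solutions A (b0, l0) \<Longrightarrow> A *v x \<noteq> b0 \<and> sgn (b0 - A *v x) = u"
    and P: "eventually P (nhds (u, l0))"
  shows "\<forall>\<^sub>F z in nhds (b0, l0). \<forall>x\<in>sr_lasso_solutions A z.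
      A *v x \<noteq> fst z \<and> P (sgn (fst z - A *v x), snd z)"
proof -
  define Q where "Q = (\<lambda>z. \<forall>x\<in>sr_lasso_solutions A z. A *v x \<noteq> fst z \<and> P (sgn (fst z - A *v x), snd z))"
  have "eventually Q (inf (nhds (b0, l0)) (principal UNIV))"
  proof (rule sequentially_imp_eventually_nhds_within, intro allI impI, elim conjE)
    fix z assume z: "z \<longlonglongrightarrow> (b0, l0)"
    show "\<forall>\<^sub>F n in sequentially. Q (z n)"
    proof (rule ccontr)
      assume "\<not> ?thesis"
      then obtain r :: "nat \<Rightarrow> nat" where r: "strict_mono r" "\<And>n. \<not> Q (z (r n))"
        using not_eventually_sequentiallyD [of "\<lambda>n. Q (z n)"] by blast
      then obtain x where x: "\<And>n. x n \<in> sr_lasso_solutions A (z (r n))"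
        "\<And>n. \<not> (A *v x n \<noteq> fst (z (r n)) \<and> P (sgn (fst (z (r n)) - A *v x n), snd (z (r n))))"
        unfolding Q_def by metis
      have zr: "(\<lambda>n. z (r n)) \<longlonglongrightarrow> (b0, l0)"
        using LIMSEQ_subseq_LIMSEQ [OF z r(1)] by (simp add: o_def)
      obtain x0 r' where x0: "x0 \<in> sr_lasso_solutions A (b0, l0)" and r': "strict_mono r'"
        and lim: "(x \<circ> r') \<longlonglongrightarrow> x0"
        by (rule solutions_subsequence_limit
            [of "\<lambda>n. fst (z (r n))" "\<lambda>n. snd (z (r n))" b0 l0 x A]) (use zr x(1) l0 in auto)
      define zz where "zz = (\<lambda>n. z (r (r' n)))"
      define xx where "xx = (\<lambda>n. x (r' n))"
      have zz: "zz \<longlonglongrightarrow> (b0, l0)"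
        using LIMSEQ_subseq_LIMSEQ [OF zr r'] by (simp add: o_def zz_def)
      have "(\<lambda>n. A *v xx n) \<longlonglongrightarrow> A *v x0"
        using lim unfolding xx_def o_def
        by (rule bounded_linear.tendsto [OF matrix_vector_mul_bounded_linear])
      then have res: "(\<lambda>n. fst (zz n) - A *v xx n) \<longlonglongrightarrow> b0 - A *v x0"
        using tendsto_fst [OF zz] by (auto intro: tendsto_diff)
      have ne: "b0 - A *v x0 \<noteq> 0" and dir: "sgn (b0 - A *v x0) = u" using nz [OF x0] by auto
      have "(\<lambda>n. (sgn (fst (zz n) - A *v xx n), snd (zz n))) \<longlonglongrightarrow> (sgn (b0 - A *v x0), l0)"
        using tendsto_snd [OF zz] by (intro tendsto_Pair tendsto_sgn res ne) simp
      then have "\<forall>\<^sub>F n in sequentially. P (sgn (fst (zz n) - A *v xx n), snd (zz n))"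
        unfolding dir by (rule eventually_compose_filterlim [OF P])
      moreover have "\<forall>\<^sub>F n in sequentially. fst (zz n) - A *v xx n \<noteq> 0"
        using tendsto_imp_eventually_ne [OF res ne] .
      ultimately have "\<forall>\<^sub>F n in sequentially. False"
        by eventually_elim (use x(2) in \<open>metis zz_def xx_def eq_iff_diff_eq_0\<close>)
      then show False by simp
    qed
  qed
  then show ?thesis by (simp add: Q_def)
qed

lemma norm_unit_diff:
  fixes u u' :: "'a::real_inner"
  assumes "norm u = 1" "norm u' = 1"
  shows "(norm (u - u'))\<^sup>2 = 2 * (1 - u \<bullet> u')"
  using assms by (simp add: power2_norm_eq_inner inner_diff norm_eq_1 inner_commute)

section \<open>Lipschitz continuity of the fitted value\<close>

text \<open>
  The Lipschitz constant of the fitted value, explicit in three bounds: \<open>\<beta>\<close> from below on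
  residual lengths, \<open>R\<close> from above on the data, and \<open>k\<close> for the \<open>\<ell>\<^sub>1\<close> norm as a function of the
  fitted value. The factor \<open>1 + (\<dots>) / \<beta>\<close> is the Lipschitz constant of the residual direction.
\<close>

definition fit_modulus :: "real \<Rightarrow> real \<Rightarrow> real \<Rightarrow> real" where
  "fit_modulus \<beta> R k =
     (1 + R / \<beta>) * (1 + R * (1 + (k * (1 + R / \<beta>) * (1 + R) + 1) / \<beta>))"

lemma fit_modulus_pos:
  assumes "0 < \<beta>" "0 \<le> R" "0 \<le> k"
  shows "0 < fit_modulus \<beta> R k"
  using assms unfolding fit_modulus_def by (intro mult_pos_pos add_pos_nonneg) auto

text \<open>
  Let \<open>u\<close>, \<open>u'\<close> be the residual directions, \<open>\<rho>\<close>, \<open>\<rho>'\<close> the residual lengths and \<open>U = \<parallel>u - u'\<parallel>\<close>.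
  The sum of the two subgradient inequalities bounds \<open>(\<rho> + \<rho>') U\<^sup>2 / 2\<close> by
  \<open>(l - l') (\<parallel>x'\<parallel>\<^sub>1 - \<parallel>x\<parallel>\<^sub>1) + (u - u') \<bullet> (b - b')\<close>. This is blind to changes of length along a
  fixed direction, but \<open>\<rho> (w \<bullet> u) = w \<bullet> b\<close> determines the length from the direction. With it, the
  right-hand side is at most of order \<open>d U + d\<^sup>2\<close>, so \<open>U\<close> is of order \<open>d\<close>.
\<close>

lemma fitted_value_lipschitz_bound:
  fixes A :: "real ^ 'n ^ 'm"
  assumes x: "x \<in> sr_lasso_solutions A (b, l)" "x' \<in> sr_lasso_solutions A (b', l')" 
    and l: "0 < l" "0 < l'" 
    and w: "norm w \<le> 1" "w \<bullet> (A *v x) = 0" "w \<bullet> (A *v x') = 0"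
    and \<beta>: "0 < \<beta>" "\<beta> \<le> w \<bullet> b" "\<beta> \<le> w \<bullet> b'" and R: "norm b \<le> R" "norm b' \<le> R"
    and k: "\<bar>l1_norm x - l1_norm x'\<bar> \<le> k * norm (A *v x - A *v x')" "0 \<le> k"
    and d: "norm (b - b') \<le> d" "\<bar>l - l'\<bar> \<le> d"
  shows "norm (A *v x - A *v x') \<le> fit_modulus \<beta> R k * d"
proof -
  define K where "K = 1 + R / \<beta>"
  define M where "M = 1 + (k * K * (1 + R) + 1) / \<beta>"
  define \<rho> where "\<rho> = norm (b - A *v x)"
  define \<rho>' where "\<rho>' = norm (b' - A *v x')"
  define u where "u = sgn (b - A *v x)"
  define u' where "u' = sgn (b' - A *v x')"
  define U where "U = norm (u - u')"
  define E where "E = norm (A *v x - A *v x')"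
  have wle: "\<bar>w \<bullet> v\<bar> \<le> norm v" for v
    using Cauchy_Schwarz_ineq2 [of w v] mult_right_mono [OF w(1), of "norm v"] by simp
  have \<rho>: "\<beta> \<le> \<rho>" "\<rho> \<le> R"
    using wle [of "b - A *v x"] w \<beta> solution_l1_bound [OF x(1)] R mult_nonneg_nonneg [OF _ l1_norm_nonneg, of l x] l
    by (auto simp: \<rho>_def inner_diff_right)
  have \<rho>': "\<beta> \<le> \<rho>'" "\<rho>' \<le> R"
    using wle [of "b' - A *v x'"] w \<beta> solution_l1_bound [OF x(2)] R mult_nonneg_nonneg [OF _ l1_norm_nonneg, of l' x'] l
    by (auto simp: \<rho>'_def inner_diff_right)
  have ne: "A *v x \<noteq> b" "A *v x' \<noteq> b'" using \<rho> \<rho>' \<beta> by (auto simp: \<rho>_def \<rho>'_def)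
  have nu: "norm u = 1" "norm u' = 1" using ne by (auto simp: u_def u'_def norm_sgn)
  have r: "b - A *v x = \<rho> *\<^sub>R u" "b' - A *v x' = \<rho>' *\<^sub>R u'"
    using ne by (simp_all add: u_def u'_def \<rho>_def \<rho>'_def sgn_div_norm)
  have Rpos: "0 < R" using \<rho> \<beta> by linarith
  have d0: "0 \<le> d" using d by (meson abs_ge_zero order_trans)
  have U0: "0 \<le> U" by (simp add: U_def)
  have wu: "\<rho> * (w \<bullet> u) = w \<bullet> b" "\<rho>' * (w \<bullet> u') = w \<bullet> b'"
    using arg_cong [OF r(1), of "inner w"] arg_cong [OF r(2), of "inner w"] w by (simp_all add: inner_diff_right)
  have "\<beta> / R \<le> w \<bullet> u"
  proof -
    have wup: "0 < w \<bullet> u" using wu(1) \<beta> \<rho> by (metis less_le_trans zero_less_mult_pos)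
    have "\<beta> \<le> \<rho> * (w \<bullet> u)" using wu \<beta> by simp
    also have "\<dots> \<le> R * (w \<bullet> u)" using \<rho> wup by (intro mult_right_mono) auto
    finally show ?thesis using Rpos by (simp add: field_simps)
  qed
  then have "\<bar>\<rho> - \<rho>'\<bar> * (\<beta> / R) \<le> \<bar>(\<rho> - \<rho>') * (w \<bullet> u)\<bar>"
    unfolding abs_mult by (intro mult_left_mono) auto
  also have "(\<rho> - \<rho>') * (w \<bullet> u) = w \<bullet> (b - b') - \<rho>' * (w \<bullet> (u - u'))"
    using wu by (simp add: algebra_simps inner_diff_right)
  also have "\<bar>\<dots>\<bar> \<le> \<bar>w \<bullet> (b - b')\<bar> + \<rho>' * \<bar>w \<bullet> (u - u')\<bar>"
    using \<rho>' \<beta> by (intro order_trans [OF abs_triangle_ineq4]) (simp add: abs_mult)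
  also have "\<dots> \<le> d + R * U"
    using wle [of "b - b'"] wle [of "u - u'"] d \<rho>' \<beta> Rpos by (intro add_mono mult_mono) (auto simp: U_def)
  finally have dr: "\<bar>\<rho> - \<rho>'\<bar> \<le> R / \<beta> * (d + R * U)"
    using \<beta> Rpos by (simp add: field_simps)
  have "A *v x - A *v x' = (b - b') - (\<rho> - \<rho>') *\<^sub>R u - \<rho>' *\<^sub>R (u - u')"
  proof -
    have "A *v x = b - \<rho> *\<^sub>R u" "A *v x' = b' - \<rho>' *\<^sub>R u'" using r by (simp_all add: algebra_simps)
    then show ?thesis by (simp add: algebra_simps)
  qed
  then have "E \<le> norm (b - b') + norm ((\<rho> - \<rho>') *\<^sub>R u) + norm (\<rho>' *\<^sub>R (u - u'))"
    using norm_triangle_ineq4 [of "b - b' - (\<rho> - \<rho>') *\<^sub>R u" "\<rho>' *\<^sub>R (u - u')"]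
      norm_triangle_ineq4 [of "b - b'" "(\<rho> - \<rho>') *\<^sub>R u"] by (simp only: E_def)
  also have "\<dots> \<le> d + R / \<beta> * (d + R * U) + R * U"
    using d dr nu \<rho>' \<beta> by (intro add_mono) (auto simp: U_def intro: mult_right_mono)
  finally have E: "E \<le> K * (d + R * U)"
    by (simp add: K_def algebra_simps)
  have K0: "0 \<le> K" using \<beta> Rpos by (simp add: K_def)
  have c: "dual_certificate A b l x u" "dual_certificate A b' l' x' u'"
    using solution_dual_certificate [OF x(1) _ ne(1)] solution_dual_certificate [OF x(2) _ ne(2)] l
    by (simp_all add: u_def u'_def)
  then have "u \<bullet> (A *v x) = l * l1_norm x" "u' \<bullet> (A *v x') = l' * l1_norm x'"
    "u \<bullet> (A *v x') \<le> l * l1_norm x'" "u' \<bullet> (A *v x) \<le> l' * l1_norm x"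
    by (auto intro!: dual_certificate_attained inner_le_l1_norm simp: dual_certificate_def)
  then have "(u - u') \<bullet> (A *v x' - A *v x) \<le> (l - l') * (l1_norm x' - l1_norm x)"
    by (simp add: inner_diff algebra_simps)
  also have "\<dots> \<le> d * (k * E)"
  proof -
    have "(l - l') * (l1_norm x' - l1_norm x) \<le> \<bar>l - l'\<bar> * \<bar>l1_norm x - l1_norm x'\<bar>"
      by (metis abs_ge_self abs_minus_commute abs_mult)
    also have "\<dots> \<le> d * (k * E)" using d k d0 by (intro mult_mono) (auto simp: E_def)
    finally show ?thesis .
  qed
  also have "\<dots> \<le> d * (k * (K * (d + R * U)))"
    using E d0 k by (intro mult_left_mono) auto
  finally have mono: "(u - u') \<bullet> (A *v x' - A *v x) \<le> d * (k * (K * (d + R * U)))" .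
  \<comment> \<open>The gradient of the norm is monotone, with a quadratic gain in the angle between two residuals.\<close>
  have "(\<rho> + \<rho>') * U\<^sup>2 = 2 * ((u - u') \<bullet> (\<rho> *\<^sub>R u - \<rho>' *\<^sub>R u'))"
    using nu unfolding U_def norm_unit_diff [OF nu]
    by (simp add: inner_diff norm_eq_1 inner_commute algebra_simps)
  also have "\<rho> *\<^sub>R u - \<rho>' *\<^sub>R u' = (b - b') + (A *v x' - A *v x)"
    unfolding r [symmetric] by (simp add: algebra_simps)
  finally have "(\<rho> + \<rho>') * U\<^sup>2 = 2 * ((u - u') \<bullet> (b - b')) + 2 * ((u - u') \<bullet> (A *v x' - A *v x))"
    by (simp add: inner_add_right)
  moreover have "(u - u') \<bullet> (b - b') \<le> U * d"
    using norm_cauchy_schwarz [of "u - u'" "b - b'"] mult_left_mono [OF d(1) U0] by (simp add: U_def)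
  moreover have "2 * \<beta> * U\<^sup>2 \<le> (\<rho> + \<rho>') * U\<^sup>2" using \<rho> \<rho>' by (intro mult_right_mono) auto
  ultimately have quad: "\<beta> * U\<^sup>2 \<le> U * d + d * (k * (K * (d + R * U)))"
    using mono by linarith
  have UM: "U \<le> M * d"
  proof (cases "U \<le> d")
    case True
    have "1 * d \<le> M * d"
      unfolding M_def using k K0 Rpos \<beta> d0 by (intro mult_right_mono) auto
    with True show ?thesis by simp
  next
    case False
    have "d * (k * (K * (d + R * U))) \<le> d * (k * (K * (U + R * U)))"
      using False d0 k K0 by (intro mult_left_mono) auto
    with quad have "U * (\<beta> * U) \<le> U * ((k * K * (1 + R) + 1) * d)"
      by (simp add: algebra_simps power2_eq_square)
    then have "\<beta> * U \<le> (k * K * (1 + R) + 1) * d"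
      using False d0 by simp
    then have "U \<le> (k * K * (1 + R) + 1) / \<beta> * d"
      using \<beta> by (simp add: field_simps)
    also have "\<dots> \<le> M * d" unfolding M_def using d0 by (intro mult_right_mono) auto
    finally show ?thesis .
  qed
  note E
  also have "K * (d + R * U) \<le> K * (d + R * (M * d))"
    using UM K0 Rpos by (intro mult_left_mono add_left_mono) auto
  also have "\<dots> = fit_modulus \<beta> R k * d"
    unfolding fit_modulus_def K_def [symmetric] M_def [symmetric] by (simp add: algebra_simps)
  finally show ?thesis by (simp add: E_def)
qed

section \<open>The range condition and local Lipschitz continuity\<close>

lemma solution_support:
  assumes "dual_certificate A b l x u" and "\<bar>column i A \<bullet> u\<bar> \<noteq> l"
  shows "x $ i = 0"
proof (rule ccontr)
  assume "x $ i \<noteq> 0"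
  have "\<bar>x $ i * (column i A \<bullet> u)\<bar> = \<bar>l * \<bar>x $ i\<bar>\<bar>"
    using assms(1) by (simp add: dual_certificate_def)
  moreover have "0 \<le> l" using assms(1) by (auto simp: dual_certificate_def intro: order_trans [OF abs_ge_zero])
  ultimately show False using assms(2) \<open>x $ i \<noteq> 0\<close> by (simp add: abs_mult)
qed

lemma locally_lipschitz_of_range_condition:
  fixes A :: "real ^ 'n ^ 'm"
  assumes l0: "0 < l0" and xbar: "xbar \<in> sr_lasso_solutions A (b0, l0)" "A *v xbar \<noteq> b0"
    and b0: "b0 \<notin> rge_columns A (J_SR A b0 l0 xbar)"
  shows "locally_hausdorff_lipschitz_at (sr_lasso_solutions A) (b0, l0)"
proof -
  define u where "u = sgn (b0 - A *v xbar)"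
  define J where "J = {i. \<bar>column i A \<bullet> u\<bar> = l0}"
  have "J_SR A b0 l0 xbar = J"
    by (simp add: J_SR_def J_def u_def sgn_div_norm norm_minus_commute)
  then obtain w where w: "norm w = 1" "\<And>i. i \<in> J \<Longrightarrow> w \<bullet> column i A = 0" "0 < w \<bullet> b0"
    using rge_columns_separation b0 by metis
  have nu: "norm u = 1" using xbar by (simp add: u_def norm_sgn)
  have cert: "dual_certificate A b0 l0 xbar u"
    unfolding u_def using solution_dual_certificate [OF xbar(1)] l0 xbar by simp
  have w_orth: "w \<bullet> (A *v x) = 0" if "\<And>i. i \<notin> J \<Longrightarrow> x $ i = 0" for x
    unfolding inner_matrix_vector_columns using that w(2)
    by (intro sum.neutral ballI) (metis inner_commute mult_eq_0_iff)
  have direction: "A *v x \<noteq> b0 \<and> sgn (b0 - A *v x) = u" if x: "x \<in> sr_lasso_solutions A (b0, l0)" for x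
  proof -
    have c: "dual_certificate A b0 l0 x u" using cert x by (rule dual_certificate_all_solutions)
    have "w \<bullet> (A *v x) = 0"
      by (intro w_orth solution_support [OF c]) (simp add: J_def)
    then have ne: "A *v x \<noteq> b0" using w by auto
    have "b0 - A *v x = norm (b0 - A *v x) *\<^sub>R u"
      using nu c by (intro unit_inner_eq_norm) (simp_all add: dual_certificate_def)
    then have "sgn (b0 - A *v x) = sgn (norm (b0 - A *v x) *\<^sub>R u)" by simp
    also have "\<dots> = u" using ne nu by (simp add: sgn_scaleR sgn_div_norm)
    finally show ?thesis using ne by simp
  qed
  \<comment> \<open>Strict inequalities of the certificate \<open>u\<close>, phrased as an open condition on nearby certificates.\<close>
  define P where "P = (\<lambda>(v, l). \<forall>i. if i \<in> J then 0 < (column i A \<bullet> v) * (column i A \<bullet> u)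
      else \<bar>column i A \<bullet> v\<bar> < l)"
  have "eventually P (nhds (u, l0))"
    unfolding P_def case_prod_unfold
  proof (rule eventually_all_finite)
    fix i
    have lim: "((\<lambda>p. p) \<longlongrightarrow> (u, l0)) (nhds (u, l0))" by (rule filterlim_ident)
    have lim_i: "((\<lambda>p. column i A \<bullet> fst p) \<longlongrightarrow> column i A \<bullet> u) (nhds (u, l0))"
      using tendsto_inner [OF tendsto_const tendsto_fst [OF lim]] by simp
    show "\<forall>\<^sub>F p in nhds (u, l0). if i \<in> J then 0 < (column i A \<bullet> fst p) * (column i A \<bullet> u)
        else \<bar>column i A \<bullet> fst p\<bar> < snd p"
    proof (cases "i \<in> J")
      case True
      then have "0 < (column i A \<bullet> u) * (column i A \<bullet> u)"
        using l0 by (auto simp: J_def zero_less_mult_iff)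
      with tendsto_mult [OF lim_i tendsto_const]
      have "\<forall>\<^sub>F p in nhds (u, l0). 0 < (column i A \<bullet> fst p) * (column i A \<bullet> u)"
        by (rule order_tendstoD)
      with True show ?thesis by simp
    next
      case False
      then have "0 < l0 - \<bar>column i A \<bullet> u\<bar>"
        using cert by (auto simp: J_def dual_certificate_def less_le)
      moreover have "((\<lambda>p. snd p - \<bar>column i A \<bullet> fst p\<bar>) \<longlongrightarrow> l0 - \<bar>column i A \<bullet> u\<bar>) (nhds (u, l0))"
        using tendsto_diff [OF tendsto_snd [OF lim] tendsto_rabs [OF lim_i]] by simp
      ultimately have "\<forall>\<^sub>F p in nhds (u, l0). 0 < snd p - \<bar>column i A \<bullet> fst p\<bar>"
        by (metis order_tendstoD(1))
      with False show ?thesis by simp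
    qed
  qed
  from residual_direction_stable [OF l0 direction this]
  have ev: "\<forall>\<^sub>F z in nhds (b0, l0). \<forall>x\<in>sr_lasso_solutions A z.
      A *v x \<noteq> fst z \<and> P (sgn (fst z - A *v x), snd z)" .
  \<comment> \<open>Half of \<open>w \<bullet> b0\<close> remains a lower bound for all data near \<open>b0\<close>.\<close>
  define \<beta> where "\<beta> = w \<bullet> b0 / 2"
  define R where "R = norm b0 + 1"
  have \<beta>: "0 < \<beta>" using w by (simp add: \<beta>_def)
  define G where "G = (\<lambda>z. \<beta> < w \<bullet> fst z \<and> norm (fst z) < R \<and> 0 < snd z \<and>
      (\<forall>x\<in>sr_lasso_solutions A z. A *v x \<noteq> fst z \<and> P (sgn (fst z - A *v x), snd z)))"
  have lim: "((\<lambda>z. z) \<longlongrightarrow> (b0, l0)) (nhds (b0, l0))" by (rule filterlim_ident)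
  have "\<forall>\<^sub>F z in nhds (b0, l0). \<beta> < w \<bullet> fst z"
    by (rule order_tendstoD [OF tendsto_inner [OF tendsto_const tendsto_fst [OF lim]]])
      (use w in \<open>simp add: \<beta>_def\<close>)
  moreover have "\<forall>\<^sub>F z in nhds (b0, l0). norm (fst z) < R"
    by (rule order_tendstoD [OF tendsto_norm [OF tendsto_fst [OF lim]]]) (simp add: R_def)
  moreover have "\<forall>\<^sub>F z in nhds (b0, l0). 0 < snd z"
    by (rule order_tendstoD [OF tendsto_snd [OF lim]]) (simp add: l0)
  moreover note ev
  ultimately have "eventually G (nhds (b0, l0))"
    unfolding G_def by eventually_elim simp
  then obtain \<delta> where \<delta>: "0 < \<delta>" and G: "\<forall>z. dist z (b0, l0) < \<delta> \<longrightarrow> G z"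
    unfolding eventually_nhds_metric by blast
  have near: "\<beta> < w \<bullet> fst z \<and> norm (fst z) < R \<and> 0 < snd z \<and>
      (\<forall>x\<in>sr_lasso_solutions A z. A *v x \<noteq> fst z \<and> P (sgn (fst z - A *v x), snd z))"
    if "z \<in> ball (b0, l0) \<delta>" for z
  proof -
    have "G z" using G that unfolding mem_ball by (metis dist_commute)
    then show ?thesis by (simp add: G_def)
  qed
  \<comment> \<open>The face of the orthant, as a box, that contains all solutions at nearby parameters.\<close>
  define T where "T = (\<lambda>i. {t. if i \<in> J then 0 \<le> t * (column i A \<bullet> u) else t = 0})"
  have T: "closed (T i) \<and> convex (T i)" for i
  proof (cases "i \<in> J")
    case True
    then have eq: "T i = {t. 0 \<le> t * (column i A \<bullet> u)}" by (simp add: T_def)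
    have "convex (T i)" unfolding eq convex_def
      by (auto simp: distrib_right mult.assoc)
    moreover have "closed (T i)" unfolding eq
      by (intro closed_Collect_le continuous_intros)
    ultimately show ?thesis by simp
  qed (simp add: T_def)
  have face: "x $ i \<in> T i"
    if z: "z \<in> ball (b0, l0) \<delta>" and x: "x \<in> sr_lasso_solutions A z" for z x i
  proof -
    define v where "v = sgn (fst z - A *v x)"
    have zz: "0 < snd z" "A *v x \<noteq> fst z" "P (v, snd z)" 
      using near [OF z] x unfolding v_def by blast+
    then have c: "dual_certificate A (fst z) (snd z) x v"
      unfolding v_def by (intro solution_dual_certificate) (use x in simp_all)
    show ?thesis
    proof (cases "i \<in> J")
      case True
      then have "0 < (column i A \<bullet> v) * (column i A \<bullet> u)" using zz by (auto simp: P_def)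
      moreover have "0 \<le> x $ i * (column i A \<bullet> v)" using c zz by (simp add: dual_certificate_def)
      ultimately have "0 \<le> x $ i * (column i A \<bullet> u)"
        by (auto simp: zero_le_mult_iff zero_less_mult_iff)
      with True show ?thesis by (simp add: T_def)
    next
      case False
      then have "\<bar>column i A \<bullet> v\<bar> < snd z" using zz by (auto simp: P_def dest: spec [of _ i])
      with c have "x $ i = 0" by (intro solution_support) auto
      with False show ?thesis by (simp add: T_def)
    qed
  qed
  have l1_face: "l0 * l1_norm x = u \<bullet> (A *v x)" if x: "\<And>i. x $ i \<in> T i" for x
  proof -
    have "l0 * \<bar>x $ i\<bar> = x $ i * (column i A \<bullet> u)" for i
    proof (cases "i \<in> J")
      case True
      then have "\<bar>x $ i * (column i A \<bullet> u)\<bar> = x $ i * (column i A \<bullet> u)" using x [of i] by (simp add: T_def)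
      with True show ?thesis by (simp add: J_def abs_mult mult.commute)
    qed (use x [of i] in \<open>simp add: T_def\<close>)
    then show ?thesis by (simp add: inner_matrix_vector_columns l1_norm_def sum_distrib_left)
  qed
  define C where "C = fit_modulus \<beta> R (1 / l0)"
  have C: "0 < C"
    unfolding C_def using \<beta> l0 by (intro fit_modulus_pos) (auto simp: R_def)
  have fitted: "norm (A *v x - A *v x') \<le> C * norm (z - z')"
    if z: "z \<in> ball (b0, l0) \<delta>" "z' \<in> ball (b0, l0) \<delta>"
      and x: "x \<in> sr_lasso_solutions A z" "x' \<in> sr_lasso_solutions A z'" for z z' x x'
    unfolding C_def
  proof (rule fitted_value_lipschitz_bound [where b = "fst z" and l = "snd z" and b' = "fst z'" and l' = "snd z'" and w = w])
    show "x \<in> sr_lasso_solutions A (fst z, snd z)" "x' \<in> sr_lasso_solutions A (fst z', snd z')"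
      using x by simp_all
    show "0 < snd z" "0 < snd z'" "\<beta> \<le> w \<bullet> fst z" "\<beta> \<le> w \<bullet> fst z'" "norm (fst z) \<le> R" "norm (fst z') \<le> R"
      using near [OF z(1)] near [OF z(2)] by auto
    show "w \<bullet> (A *v x) = 0" "w \<bullet> (A *v x') = 0"
      using face [OF z(1) x(1)] face [OF z(2) x(2)] by (auto intro!: w_orth simp: T_def split: if_splits)
    have "l0 * \<bar>l1_norm x - l1_norm x'\<bar> = \<bar>l0 * l1_norm x - l0 * l1_norm x'\<bar>"
      using l0 by (simp add: abs_mult right_diff_distrib [symmetric])
    also have "\<dots> = \<bar>u \<bullet> (A *v x - A *v x')\<bar>"
      using l1_face face z x by (simp add: inner_diff_right)
    also have "\<dots> \<le> norm (A *v x - A *v x')"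
      using Cauchy_Schwarz_ineq2 [of u] nu by (metis mult_1)
    finally show "\<bar>l1_norm x - l1_norm x'\<bar> \<le> 1 / l0 * norm (A *v x - A *v x')"
      using l0 by (simp add: field_simps)
    show "norm (fst z - fst z') \<le> norm (z - z')" "\<bar>snd z - snd z'\<bar> \<le> norm (z - z')"
      using norm_fst_le [of "fst (z - z')" "snd (z - z')"] norm_snd_le [of "snd (z - z')" "fst (z - z')"]
      unfolding prod.collapse by simp_all
  qed (use w \<beta> l0 in auto)
  obtain H where H: "0 < H" and hoffman: "\<And>x x0. (\<And>i. x $ i \<in> T i) \<Longrightarrow> (\<And>i. x0 $ i \<in> T i) \<Longrightarrow>
    \<exists>x'. (\<forall>i. x' $ i \<in> T i) \<and> A *v x' = A *v x0 \<and> norm (x' - x) \<le> H * norm (A *v x0 - A *v x)"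
    by (rule box_hoffman_bound [of T A]) (use T in blast)+
  have excess: "set_excess (sr_lasso_solutions A z) (sr_lasso_solutions A z') \<le> ennreal (H * C * norm (z - z'))"
    if z: "z \<in> ball (b0, l0) \<delta>" "z' \<in> ball (b0, l0) \<delta>" for z z'
  proof (rule set_excess_leI)
    fix x assume x: "x \<in> sr_lasso_solutions A z"
    obtain x0 where x0: "x0 \<in> sr_lasso_solutions A z'"
      using solutions_nonempty [of "snd z'" A "fst z'"] near [OF z(2)] by auto
    obtain x' where x': "\<And>i. x' $ i \<in> T i" "A *v x' = A *v x0" "norm (x' - x) \<le> H * norm (A *v x0 - A *v x)"
      using hoffman face [OF z(1) x] face [OF z(2) x0] by metis
    \<comment> \<open>Within the face the objective depends on the fitted value only, so \<open>x'\<close> is optimal as well.\<close>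
    have "l0 * l1_norm x' = l0 * l1_norm x0"
      using l1_face [OF x'(1)] l1_face [OF face [OF z(2) x0]] x'(2) by simp
    then have "l1_norm x' = l1_norm x0" using l0 by simp
    then have "x' \<in> sr_lasso_solutions A (fst z', snd z') \<longleftrightarrow> x0 \<in> sr_lasso_solutions A (fst z', snd z')"
      unfolding sr_lasso_solutions_iff x'(2) by simp
    then have "x' \<in> sr_lasso_solutions A z'" using x0 by simp
    moreover have "dist x x' \<le> H * C * norm (z - z')"
    proof -
      note x'(3)
      also have "H * norm (A *v x0 - A *v x) \<le> H * (C * norm (z - z'))"
        using fitted [OF z(1) z(2) x x0] H by (intro mult_left_mono) (auto simp: norm_minus_commute)
      finally show ?thesis by (simp add: dist_norm norm_minus_commute mult.assoc)
    qed
    ultimately show "\<exists>y\<in>sr_lasso_solutions A z'. dist x y \<le> H * C * norm (z - z')" by auto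
  qed
  show ?thesis
    unfolding locally_hausdorff_lipschitz_at_def hausdorff_distance_def
  proof (rule exI [of _ \<delta>], intro conjI \<delta>, rule exI [of _ "H * C"], intro conjI ballI)
    show "0 < H * C" using H C by simp
    fix z z' assume z: "z \<in> ball (b0, l0) \<delta>" "z' \<in> ball (b0, l0) \<delta>"
    show "max (set_excess (sr_lasso_solutions A z) (sr_lasso_solutions A z'))
        (set_excess (sr_lasso_solutions A z') (sr_lasso_solutions A z)) \<le> ennreal (H * C * norm (z - z'))"
      using excess [OF z] excess [OF z(2) z(1)] by (simp add: norm_minus_commute)
  qed
qed

lemma range_condition_of_locally_lipschitz:
  fixes A :: "real ^ 'n ^ 'm"
  assumes l0: "0 < l0" and xbar: "xbar \<in> sr_lasso_solutions A (b0, l0)" "A *v xbar \<noteq> b0"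
    and lip: "locally_hausdorff_lipschitz_at (sr_lasso_solutions A) (b0, l0)"
  shows "b0 \<notin> rge_columns A (J_SR A b0 l0 xbar)"
proof
  assume mem: "b0 \<in> rge_columns A (J_SR A b0 l0 xbar)"
  define u where "u = sgn (b0 - A *v xbar)"
  define \<rho> where "\<rho> = norm (b0 - A *v xbar)"
  define J where "J = {i. \<bar>column i A \<bullet> u\<bar> = l0}"
  have J: "J_SR A b0 l0 xbar = J"
    by (simp add: J_SR_def J_def u_def sgn_div_norm norm_minus_commute)
  have \<rho>: "0 < \<rho>" using xbar by (simp add: \<rho>_def)
  have nu: "norm u = 1" using xbar by (simp add: u_def norm_sgn)
  have cert: "dual_certificate A b0 l0 xbar u"
    unfolding u_def using solution_dual_certificate [OF xbar(1)] l0 xbar by simp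
  have supp: "xbar $ i = 0" if "i \<notin> J" for i
    using solution_support [OF cert] that by (simp add: J_def)
  have inJ: "\<bar>column i A \<bullet> u\<bar> = l0" "column i A \<bullet> u \<noteq> 0" if "i \<in> J" for i
    using that l0 by (auto simp: J_def)
  obtain c0 where c0: "b0 = (\<Sum>i\<in>J. c0 i *\<^sub>R column i A)"
    using mem unfolding J rge_columns_def by blast
  \<comment> \<open>Subtracting the representations of \<open>b0\<close> and \<open>A xbar\<close> represents the residual direction by \<open>J\<close>.\<close>
  define c where "c = (\<chi> i. if i \<in> J then (c0 i - xbar $ i) / \<rho> else 0)"
  have Ac: "A *v c = u"
  proof -
    have cols: "A *v y = (\<Sum>i\<in>J. y $ i *\<^sub>R column i A)" if "\<And>i. i \<notin> J \<Longrightarrow> y $ i = 0" for y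
      unfolding matrix_mult_sum scalar_mult_eq_scaleR using that by (intro sum.mono_neutral_right) auto
    have "A *v c = (1 / \<rho>) *\<^sub>R (b0 - A *v xbar)"
      unfolding c0 by (subst (1 2) cols) (auto simp: c_def supp scaleR_right.sum sum_subtractf [symmetric]
          algebra_simps diff_divide_distrib intro!: sum.cong)
    then show ?thesis by (simp add: u_def \<rho>_def sgn_div_norm divide_inverse)
  qed
  obtain \<delta> L where \<delta>: "0 < \<delta>" and L: "0 < L" and
    dH: "\<And>z z'. z \<in> ball (b0, l0) \<delta> \<Longrightarrow> z' \<in> ball (b0, l0) \<delta> \<Longrightarrow>
      hausdorff_distance (sr_lasso_solutions A z) (sr_lasso_solutions A z') \<le> ennreal (L * norm (z - z'))"
    using lip unfolding locally_hausdorff_lipschitz_at_def by blast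
  \<comment> \<open>Moving \<open>xbar\<close> along \<open>v\<close> makes the coordinates in \<open>J\<close> nonzero with the signs that \<open>u\<close> certifies.\<close>
  define v where "v = (\<chi> i. if i \<in> J then column i A \<bullet> u else 0)"
  define e where "e = \<delta> / (2 * (norm (A *v v) + 1))"
  have pos: "0 < 2 * (norm (A *v v) + 1)" by (simp add: add_nonneg_pos)
  have e: "0 < e" using \<delta> pos unfolding e_def by (rule divide_pos_pos)
  have ev: "norm (e *\<^sub>R (A *v v)) < \<delta> / 2"
    using e pos \<delta> by (simp add: e_def field_simps)
  define b where "b = b0 + e *\<^sub>R (A *v v)"
  define x where "x = xbar + e *\<^sub>R v"
  have res: "b - A *v x = b0 - A *v xbar"
    by (simp add: b_def x_def matrix_vector_right_distrib matrix_vector_mult_scaleR)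
  have xpos: "0 < x $ i * (column i A \<bullet> u)" if "i \<in> J" for i
  proof -
    have "0 \<le> xbar $ i * (column i A \<bullet> u)" using cert l0 by (simp add: dual_certificate_def)
    moreover have "0 < e * ((column i A \<bullet> u) * (column i A \<bullet> u))"
      using e inJ [OF that] by (auto simp: zero_less_mult_iff)
    ultimately show ?thesis using that by (simp add: x_def v_def algebra_simps)
  qed
  have "dual_certificate A b l0 x u"
    unfolding dual_certificate_def res
  proof (intro conjI allI)
    show "x $ i * (column i A \<bullet> u) = l0 * \<bar>x $ i\<bar>" for i
    proof (cases "i \<in> J")
      case True
      have "x $ i * (column i A \<bullet> u) = \<bar>x $ i * (column i A \<bullet> u)\<bar>" using xpos [OF True] by simp
      then show ?thesis using inJ [OF True] by (simp add: abs_mult mult.commute)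
    qed (simp add: x_def v_def supp)
  qed (use cert in \<open>auto simp: dual_certificate_def\<close>)
  then have x: "x \<in> sr_lasso_solutions A (b, l0)" by (rule dual_certificate_imp_solution)
  have "\<forall>\<^sub>F y in nhds x. A *v y \<noteq> b \<and> (\<forall>i. i \<in> J \<longrightarrow> 0 < y $ i * (column i A \<bullet> u))"
  proof (intro eventually_conj eventually_all_finite)
    have lim: "((\<lambda>y. y) \<longlongrightarrow> x) (nhds x)" by (rule filterlim_ident)
    have "A *v x \<noteq> b" using res xbar by auto
    then show "\<forall>\<^sub>F y in nhds x. A *v y \<noteq> b"
      using bounded_linear.tendsto [OF matrix_vector_mul_bounded_linear lim] tendsto_imp_eventually_ne by blast
    fix i
    have "((\<lambda>y. y $ i * (column i A \<bullet> u)) \<longlongrightarrow> x $ i * (column i A \<bullet> u)) (nhds x)"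
      by (intro tendsto_intros lim)
    then show "\<forall>\<^sub>F y in nhds x. i \<in> J \<longrightarrow> 0 < y $ i * (column i A \<bullet> u)"
      using xpos [of i] by (cases "i \<in> J") (auto dest: order_tendstoD(1))
  qed
  then obtain \<gamma> where \<gamma>: "0 < \<gamma>"
    "\<And>y. dist y x < \<gamma> \<Longrightarrow> A *v y \<noteq> b \<and> (\<forall>i. i \<in> J \<longrightarrow> 0 < y $ i * (column i A \<bullet> u))"
    unfolding eventually_nhds_metric by blast
  define \<eta> where "\<eta> = min (\<delta> / 2) (\<gamma> / (2 * L))"
  have \<eta>: "0 < \<eta>" "\<eta> \<le> \<delta> / 2" "L * \<eta> < \<gamma>"
  proof -
    show "0 < \<eta>" "\<eta> \<le> \<delta> / 2" using \<delta> \<gamma> L by (auto simp: \<eta>_def)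
    have "L * \<eta> \<le> L * (\<gamma> / (2 * L))" using L by (intro mult_left_mono) (auto simp: \<eta>_def)
    then show "L * \<eta> < \<gamma>" using L \<gamma> by simp
  qed
  have near: "(b, l) \<in> ball (b0, l0) \<delta>" if "\<bar>l - l0\<bar> \<le> \<delta> / 2" for l
  proof -
    have "norm ((b0, l0) - (b, l)) \<le> norm (b0 - b) + norm (l0 - l)"
      using norm_Pair_le [of "b0 - b" "l0 - l"] by simp
    also have "\<dots> < \<delta>"
      using ev that by (simp add: b_def norm_minus_commute abs_minus_commute)
    finally show ?thesis by (simp only: mem_ball dist_norm)
  qed
  have "set_excess (sr_lasso_solutions A (b, l0)) (sr_lasso_solutions A (b, l0 + \<eta>)) \<le> ennreal (L * \<eta>)"
    using dH [OF near [of l0] near [of "l0 + \<eta>"]] \<eta> \<delta> by (simp add: hausdorff_distance_def norm_Pair)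
  from set_excess_leD [OF this x \<eta>(3) \<gamma>(1)]
  obtain y where y: "y \<in> sr_lasso_solutions A (b, l0 + \<eta>)" "dist y x < \<gamma>"
    by (auto simp: dist_commute)
  define u' where "u' = sgn (b - A *v y)"
  have cert': "dual_certificate A b (l0 + \<eta>) y u'"
    unfolding u'_def using \<gamma>(2) [OF y(2)] l0 \<eta> by (intro solution_dual_certificate y) auto
  have scaled: "l0 * (column i A \<bullet> u') = (l0 + \<eta>) * (column i A \<bullet> u)" if "i \<in> J" for i
  proof -
    have pos: "0 < y $ i * (column i A \<bullet> u)" using \<gamma>(2) [OF y(2)] that by blast
    then have "\<bar>y $ i\<bar> * l0 = y $ i * (column i A \<bullet> u)"
      using abs_mult [of "y $ i" "column i A \<bullet> u"] inJ [OF that] by simp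
    moreover have "y $ i * (column i A \<bullet> u') = (l0 + \<eta>) * \<bar>y $ i\<bar>"
      using cert' by (simp add: dual_certificate_def)
    then have "y $ i * (l0 * (column i A \<bullet> u')) = (l0 + \<eta>) * (\<bar>y $ i\<bar> * l0)"
      by (simp add: algebra_simps)
    ultimately have "y $ i * (l0 * (column i A \<bullet> u')) = y $ i * ((l0 + \<eta>) * (column i A \<bullet> u))"
      by (simp add: algebra_simps)
    moreover have "y $ i \<noteq> 0" using pos by auto
    ultimately show ?thesis by (metis mult_left_cancel)
  qed
  \<comment> \<open>The direction \<open>u = A c\<close> sees only columns in \<open>J\<close>, on which \<open>u'\<close> is a multiple of \<open>u\<close>.\<close>
  have "l0 * (u' \<bullet> u) = (\<Sum>i\<in>UNIV. c $ i * (l0 * (column i A \<bullet> u')))"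
    unfolding Ac [symmetric] by (simp add: inner_matrix_vector_columns sum_distrib_left mult.left_commute)
  also have "\<dots> = (\<Sum>i\<in>UNIV. c $ i * ((l0 + \<eta>) * (column i A \<bullet> u)))"
    using scaled by (intro sum.cong refl) (auto simp: c_def)
  also have "\<dots> = (l0 + \<eta>) * (u \<bullet> (A *v c))"
    by (simp add: inner_matrix_vector_columns sum_distrib_left mult.left_commute)
  also have "\<dots> = l0 + \<eta>" using nu by (simp add: Ac norm_eq_1)
  finally have "l0 * (u' \<bullet> u) = l0 + \<eta>" .
  moreover have "u' \<bullet> u \<le> 1"
    using norm_cauchy_schwarz [of u' u] nu cert' by (simp add: dual_certificate_def)
  then have "l0 * (u' \<bullet> u) \<le> l0" using l0 by simp
  ultimately show False using \<eta> by simp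
qed

text \<open>
  The hypothesis on fitted values provides a solution with nonzero residual, at which the necessity
  argument starts.
\<close>

theorem theorem5p1:
  fixes A :: "real ^ 'n ^ 'm" and bbar :: "real ^ 'm" and lbar :: real
  assumes "lbar > 0"
    and "(\<lambda>x. A *v x) ` sr_lasso_solutions A (bbar, lbar) \<noteq> {bbar}"
  shows "locally_hausdorff_lipschitz_at (sr_lasso_solutions A) (bbar, lbar) \<longleftrightarrow>
    (\<exists>xbar \<in> sr_lasso_solutions A (bbar, lbar).
        A *v xbar \<noteq> bbar \<and> bbar \<notin> rge_columns A (J_SR A bbar lbar xbar))"
proof
  assume "locally_hausdorff_lipschitz_at (sr_lasso_solutions A) (bbar, lbar)"
  moreover obtain xbar where "xbar \<in> sr_lasso_solutions A (bbar, lbar)" "A *v xbar \<noteq> bbar"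
    using assms(2) solutions_nonempty [OF assms(1), of A bbar] by auto
  ultimately show "\<exists>xbar \<in> sr_lasso_solutions A (bbar, lbar).
        A *v xbar \<noteq> bbar \<and> bbar \<notin> rge_columns A (J_SR A bbar lbar xbar)"
    using range_condition_of_locally_lipschitz [OF assms(1)] by blast
next
  assume "\<exists>xbar \<in> sr_lasso_solutions A (bbar, lbar).
        A *v xbar \<noteq> bbar \<and> bbar \<notin> rge_columns A (J_SR A bbar lbar xbar)"
  then show "locally_hausdorff_lipschitz_at (sr_lasso_solutions A) (bbar, lbar)"
    using locally_lipschitz_of_range_condition [OF assms(1)] by blast
qed

end
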